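(* For a Puiseux monoid $M$ the following conditions are equivalent: (1) $M$ is finite (as a Puiseux monoid) and, for every prime $p$, the set $\{\mathsf{v}_p(x) \mid x\in M\}$ is bounded from below; (2) $M$ is finite (as a Puiseux monoid) and, for every set $R$ with $M=\langle R\rangle$ and every prime $p$, the set $\{\mathsf{v}_p(r)\mid r\in R\}$ is bounded from below; (3) the denominator set $\mathsf{d}(M^\bullet)$ is bounded; (4) for every set $R$ with $M=\langle R\rangle$, the denominator set $\mathsf{d}(R^\bullet)$ is bounded. Moreover, if one (and so all) of these conditions holds, then $M$ is atomic.
   Context: A Puiseux monoid is an additive submonoid of $\mathbb{Q}_{\ge 0}$. $\langle R\rangle$ denotes the submonoid generated by $R$. For $S\subseteq\mathbb{Q}$, $S^\bullet = S\setminus\{0\}$. For $r\in\mathbb{Q}_{>0}$, $\mathsf{n}(r),\mathsf{d}(r)\in\mathbb{N}$ are the unique positive integers with $r=\mathsf{n}(r)/\mathsf{d}(r)$ and $\gcd(\mathsf{n}(r),\mathsf{d}(r))=1$; for $R\subseteq \mathbb{Q}_{>0}$, $\mathsf{d}(R)=\{\mathsf{d}(r)\mid r\in R\}$ is its denominator set. For a prime $p$, $\mathsf{v}_p:\mathbb{Q}\to\mathbb{Z}\cup\{\infty\}$ is the $p$-adic valuation, with $\mathsf{v}_p(0)=\infty$. For a set of primes $P$, a Puiseux monoid over $P$ is a Puiseux monoid $M$ such that $\mathsf{v}_p(m)\ge 0$ for every $m\in M$ and every prime $p\notin P$. A Puiseux monoid is called finite if there is a finite set of primes $P$ such that it is a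 Puiseux monoid over $P$ (this does not mean finite cardinality). An atom of $M$ is a nonzero $a\in M$ such that $a=x+y$ with $x,y\in M$ implies $x=0$ or $y=0$; $M$ is atomic if every nonzero element of $M$ is a finite sum of atoms. *)

theory Defs
  imports Complex_Main "HOL-Computational_Algebra.Primes" "HOL-Library.Multiset"
    "HOL-Library.Extended"
begin

definition add_submonoid :: "'a::monoid_add set \<Rightarrow> bool" where
  "add_submonoid S \<longleftrightarrow> 0 \<in> S \<and> (\<forall>x\<in>S. \<forall>y\<in>S. x + y \<in> S)"

definition puiseux_monoid :: "rat set \<Rightarrow> bool" where
  "puiseux_monoid M \<longleftrightarrow> add_submonoid M \<and> (\<forall>x\<in>M. 0 \<le> x)"

definition generated_submonoid :: "'a::monoid_add set \<Rightarrow> 'a set" where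
  "generated_submonoid R = add_submonoid hull R"

definition denominator :: "rat \<Rightarrow> nat" where
  "denominator r = nat (snd (quotient_of r))"

definition denominator_set :: "rat set \<Rightarrow> nat set" where
  "denominator_set R = denominator ` R"

definition padic_val :: "nat \<Rightarrow> rat \<Rightarrow> int extended" where
  "padic_val p x =
    (if x = 0 then \<infinity>
     else Fin (int (multiplicity (int p) (fst (quotient_of x)))
             - int (multiplicity (int p) (snd (quotient_of x)))))"

text \<open>
  A set of values of \<open>padic_val\<close> is bounded from below if it has an integer lower bound.
  Note that \<^const>\<open>bdd_below\<close> would hold for every set here, since the type
  \<^typ>\<open>int extended\<close> also has a least element \<open>-\<infinity>\<close>, which is never a value of \<open>padic_val\<close>.
\<close>

definition bounded_from_below :: "int extended set \<Rightarrow> bool" where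
  "bounded_from_below S \<longleftrightarrow> (\<exists>b::int. \<forall>s\<in>S. Fin b \<le> s)"

definition puiseux_monoid_over :: "nat set \<Rightarrow> rat set \<Rightarrow> bool" where
  "puiseux_monoid_over P M \<longleftrightarrow>
    puiseux_monoid M \<and> (\<forall>m\<in>M. \<forall>p. prime p \<and> p \<notin> P \<longrightarrow> 0 \<le> padic_val p m)"

text \<open>Finiteness of a Puiseux monoid concerns the primes involved, not its cardinality.\<close>

definition finite_puiseux_monoid :: "rat set \<Rightarrow> bool" where
  "finite_puiseux_monoid M \<longleftrightarrow>
    (\<exists>P. finite P \<and> (\<forall>p\<in>P. prime p) \<and> puiseux_monoid_over P M)"

definition atoms :: "'a::monoid_add set \<Rightarrow> 'a set" where
  "atoms M = {a \<in> M. a \<noteq> 0 \<and> (\<forall>x\<in>M. \<forall>y\<in>M. a = x + y \<longrightarrow> x = 0 \<or> y = 0)}"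

definition atomic :: "'a::comm_monoid_add set \<Rightarrow> bool" where
  "atomic M \<longleftrightarrow> (\<forall>x\<in>M. x \<noteq> 0 \<longrightarrow> (\<exists>A. set_mset A \<subseteq> atoms M \<and> x = sum_mset A))"

end

theory Submission
  imports Defs
begin

text \<open>
  All four conditions say the same thing about denominators: there is one positive integer \<open>N\<close>
  with \<open>N M \<subseteq> \<nat>\<close>. Bounded denominators have such a common multiple, a factorial. Bounds on
  valuations give a lower bound for every prime separately, which is the same as a bound on the
  exponent of that prime in the denominators (\<open>padic_val_ge_iff\<close>); when only finitely many primes
  occur, the product of the corresponding prime powers is a common multiple
  (\<open>finite_valuations_bounded_iff\<close>). A bound for all generating sets is a
  bound for \<open>M\<close> and conversely, because \<open>M\<close> generates itself and every generating set lies in \<open>M\<close>.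

  Multiplication by \<open>N\<close> embeds \<open>M\<close> into \<open>\<nat>\<close>, where each proper splitting \<open>x = y + z\<close> makes both
  summands smaller; splitting therefore ends, and it ends in atoms.
\<close>

section \<open>Valuations and denominators of rational numbers\<close>

lemma denominator_pos: "0 < denominator x"
  by (simp add: denominator_def quotient_of_denom_pos')

lemma int_denominator: "int (denominator x) = snd (quotient_of x)"
  using quotient_of_denom_pos'[of x] by (simp add: denominator_def)

lemma denominator_0 [simp]: "denominator 0 = 1"
  by (simp add: denominator_def)

lemma multiplicity_int_int: "multiplicity (int p) (int n) = multiplicity p n"
  by (simp add: multiplicity_def flip: of_nat_power)

text \<open>
  Since numerator and denominator are coprime, a prime divides at most one of them. A bound
  \<open>- k \<le> 0\<close> is therefore a condition on the denominator alone.
\<close>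

lemma padic_val_ge_iff:
  assumes "prime p"
  shows "Fin (- int k) \<le> padic_val p x \<longleftrightarrow> multiplicity p (denominator x) \<le> k"
proof (cases "x = 0")
  case False
  have den: "multiplicity (int p) (snd (quotient_of x)) = multiplicity p (denominator x)"
    by (simp add: multiplicity_int_int flip: int_denominator)
  have "coprime (fst (quotient_of x)) (snd (quotient_of x))"
    by (metis prod.collapse quotient_of_coprime)
  then have "\<not> int p dvd fst (quotient_of x) \<or> \<not> int p dvd snd (quotient_of x)"
    using coprime_common_divisor[of _ _ "int p"] not_prime_unit[of "int p"]
      prime_nat_int_transfer[THEN iffD2, OF assms] by blast
  then have "multiplicity (int p) (fst (quotient_of x)) = 0 \<or> multiplicity p (denominator x) = 0"
    using den not_dvd_imp_multiplicity_0 by metis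
  then show ?thesis
    using False den by (auto simp: padic_val_def)
qed (simp add: padic_val_def)

lemma denominator_dvd_imp_mult_in_Nats:
  assumes "denominator x dvd N" "0 \<le> x"
  obtains n where "of_nat N * x = of_nat n"
proof -
  obtain k where k: "N = denominator x * k"
    using assms(1) by blast
  have "x = of_int (fst (quotient_of x)) / of_int (snd (quotient_of x))"
    by (metis prod.collapse quotient_of_div)
  then have "of_nat (denominator x) * x = of_int (fst (quotient_of x))"
    using denominator_pos[of x]
    by (metis int_denominator nonzero_mult_div_cancel_left of_int_of_nat_eq of_nat_eq_0_iff
        less_irrefl times_divide_eq_right)
  then have "of_nat N * x = of_int (int k * fst (quotient_of x))"
    by (simp add: k ac_simps)
  moreover from this have "0 \<le> int k * fst (quotient_of x)"
    by (metis assms(2) mult_nonneg_nonneg of_int_0_le_iff of_nat_0_le_iff)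
  ultimately show thesis
    by (metis that of_int_of_nat_eq zero_le_imp_eq_int)
qed

lemma bdd_above_denominators_iff:
  "bdd_above (denominator_set S) \<longleftrightarrow> (\<exists>N>0. \<forall>x\<in>S. denominator x dvd N)"
proof
  assume "bdd_above (denominator_set S)"
  then obtain B where "\<And>x. x \<in> S \<Longrightarrow> denominator x \<le> B"
    by (auto simp: bdd_above_def denominator_set_def)
  then have "\<forall>x\<in>S. denominator x dvd fact B"
    using denominator_pos by (auto intro!: dvd_fact simp: Suc_le_eq)
  then show "\<exists>N>0. \<forall>x\<in>S. denominator x dvd N"
    using fact_gt_zero by blast
next
  assume "\<exists>N>0. \<forall>x\<in>S. denominator x dvd N"
  then show "bdd_above (denominator_set S)"
    by (auto simp: bdd_above_def denominator_set_def dest: dvd_imp_le)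
qed

section \<open>Finite Puiseux monoids with bounded valuations\<close>

lemma finite_valuations_bounded_iff:
  assumes "puiseux_monoid M"
  shows "finite_puiseux_monoid M \<and> (\<forall>p. prime p \<longrightarrow> bounded_from_below (padic_val p ` M))
         \<longleftrightarrow> (\<exists>N>0. \<forall>x\<in>M. denominator x dvd N)"
    (is "?finite \<and> ?bounded \<longleftrightarrow> ?common")
proof
  assume c1: "?finite \<and> ?bounded"
  then obtain P where P: "finite P" "\<forall>p\<in>P. prime p" "puiseux_monoid_over P M"
    by (auto simp: finite_puiseux_monoid_def)
  have "\<exists>k. \<forall>x\<in>M. multiplicity p (denominator x) \<le> k" if p: "prime p" for p
  proof -
    obtain b where b: "\<And>x. x \<in> M \<Longrightarrow> Fin b \<le> padic_val p x"
      using c1 p unfolding bounded_from_below_def by blast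
    \<comment> \<open>A positive lower bound \<open>b\<close> is weakened to \<open>0\<close>.\<close>
    have "Fin (- int (nat (- b))) \<le> Fin b"
      by simp
    then have "\<forall>x\<in>M. multiplicity p (denominator x) \<le> nat (- b)"
      using b order_trans padic_val_ge_iff[OF p] by blast
    then show ?thesis ..
  qed
  then obtain k where k: "\<And>p x. prime p \<Longrightarrow> x \<in> M \<Longrightarrow> multiplicity p (denominator x) \<le> k p"
    by metis
  have outside: "multiplicity p (denominator x) = 0" if "prime p" "p \<notin> P" "x \<in> M" for p x
    using that P(3) padic_val_ge_iff[of p 0 x]
    by (simp add: puiseux_monoid_over_def zero_extended_def)
  define N where "N = (\<Prod>p\<in>P. p ^ k p)"
  have N: "0 < N"
    using P(2) by (auto simp: N_def prime_gt_0_nat intro!: prod_pos)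
  have "denominator x dvd N" if x: "x \<in> M" for x
  proof (rule multiplicity_le_imp_dvd)
    fix p :: nat
    assume p: "prime p"
    have "multiplicity p N = (if p \<in> P then k p else 0)"
      unfolding N_def using P p by (intro multiplicity_prod_prime_powers) auto
    then show "multiplicity p (denominator x) \<le> multiplicity p N"
      using k outside p x by auto
  qed (use denominator_pos[of x] in simp)
  with N show ?common
    by blast
next
  assume ?common
  then obtain N where N: "0 < N" "\<And>x. x \<in> M \<Longrightarrow> denominator x dvd N"
    by blast
  have val: "Fin (- int (multiplicity p N)) \<le> padic_val p x" if "prime p" "x \<in> M" for p x
    using that N by (simp add: padic_val_ge_iff dvd_imp_multiplicity_le)
  have "puiseux_monoid_over (prime_factors N) M"
    unfolding puiseux_monoid_over_def
  proof (intro conjI ballI allI impI, fact assms)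
    fix x p
    assume "x \<in> M" "prime p \<and> p \<notin> prime_factors N"
    then show "0 \<le> padic_val p x"
      using val[of p x] by (simp add: prime_factors_multiplicity zero_extended_def)
  qed
  then have ?finite
    unfolding finite_puiseux_monoid_def by (intro exI[of _ "prime_factors N"]) auto
  moreover have ?bounded
    using val by (auto simp: bounded_from_below_def)
  ultimately show "?finite \<and> ?bounded" ..
qed

section \<open>Atomicity and generating sets\<close>

text \<open>
  The natural number \<open>n = N x\<close> measures \<open>x\<close>. It is positive for nonzero \<open>x\<close> and additive, so it
  decreases strictly when \<open>x\<close> is written as a sum of two nonzero elements.
\<close>

lemma atomic_if_common_denominator:
  assumes M: "puiseux_monoid M" and N: "0 < N" "\<forall>x\<in>M. denominator x dvd N"
  shows "atomic M"
proof -
  have factor: "\<exists>A. set_mset A \<subseteq> atoms M \<and> x = sum_mset A"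
    if "x \<in> M" "x \<noteq> 0" "of_nat N * x = of_nat n" for x n
    using that
  proof (induction n arbitrary: x rule: less_induct)
    case (less n)
    show ?case
    proof (cases "x \<in> atoms M")
      case True
      then show ?thesis
        by (intro exI[of _ "{#x#}"]) simp
    next
      case False
      then obtain y z where yz: "y \<in> M" "z \<in> M" "x = y + z" "y \<noteq> 0" "z \<noteq> 0"
        using less.prems by (auto simp: atoms_def)
      then have pos: "0 < y" "0 < z"
        using M by (auto simp: puiseux_monoid_def less_le)
      obtain i where i: "of_nat N * y = of_nat i"
        using denominator_dvd_imp_mult_in_Nats[of y N] N(2) yz(1) pos by auto
      obtain j where j: "of_nat N * z = of_nat j"
        using denominator_dvd_imp_mult_in_Nats[of z N] N(2) yz(2) pos by auto
      have "0 < (of_nat i :: rat)" "0 < (of_nat j :: rat)"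
        using pos N(1) by (simp_all flip: i j)
      moreover have "(of_nat n :: rat) = of_nat (i + j)"
        using less.prems(3) i j yz(3) by (simp add: distrib_left)
      ultimately have "i < n" "j < n"
        by (simp_all only: of_nat_eq_iff of_nat_0_less_iff)
      then obtain A B where "set_mset A \<subseteq> atoms M" "y = sum_mset A"
        "set_mset B \<subseteq> atoms M" "z = sum_mset B"
        using less.IH yz i j by metis
      then show ?thesis
        using yz(3) by (intro exI[of _ "A + B"]) simp
    qed
  qed
  show ?thesis
    unfolding atomic_def
  proof (intro ballI impI)
    fix x
    assume x: "x \<in> M" "x \<noteq> 0"
    then obtain n where "of_nat N * x = of_nat n"
      using M N(2) denominator_dvd_imp_mult_in_Nats[of x N] by (auto simp: puiseux_monoid_def)
    with x show "\<exists>A. set_mset A \<subseteq> atoms M \<and> x = sum_mset A"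
      by (rule factor)
  qed
qed

lemma generated_submonoid_self:
  "add_submonoid M \<Longrightarrow> generated_submonoid M = M"
  unfolding generated_submonoid_def by (rule hull_same)

lemma generators_subset: "R \<subseteq> generated_submonoid R"
  unfolding generated_submonoid_def by (rule hull_subset)

text \<open>
  A property of sets that passes to subsets holds for all generating sets of \<open>M\<close> as soon as it
  holds for the largest one, \<open>M\<close> itself.
\<close>

lemma all_generating_sets_iff:
  assumes "add_submonoid M" and "\<And>R. R \<subseteq> M \<Longrightarrow> Q M \<Longrightarrow> Q R"
  shows "(\<forall>R. M = generated_submonoid R \<longrightarrow> Q R) \<longleftrightarrow> Q M"
  using assms(2) generated_submonoid_self[OF assms(1)] generators_subset by blast

theorem proposition3p8:
  fixes M :: "rat set"
  assumes "puiseux_monoid M"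
  shows
    "let
       c1 = (finite_puiseux_monoid M \<and>
         (\<forall>p. prime p \<longrightarrow> bounded_from_below (padic_val p ` M)));
       c2 = (finite_puiseux_monoid M \<and>
         (\<forall>R. M = generated_submonoid R \<longrightarrow>
           (\<forall>p. prime p \<longrightarrow> bounded_from_below (padic_val p ` R))));
       c3 = bdd_above (denominator_set (M - {0}));
       c4 = (\<forall>R. M = generated_submonoid R \<longrightarrow> bdd_above (denominator_set (R - {0})))
     in (c1 \<longleftrightarrow> c2) \<and> (c2 \<longleftrightarrow> c3) \<and> (c3 \<longleftrightarrow> c4) \<and> (c1 \<or> c2 \<or> c3 \<or> c4 \<longrightarrow> atomic M)"
proof -
  let ?common = "\<exists>N>0. \<forall>x\<in>M. denominator x dvd N"
  have M: "add_submonoid M"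
    using assms by (simp add: puiseux_monoid_def)
  have c2_generators: "(\<forall>R. M = generated_submonoid R \<longrightarrow>
      (\<forall>p. prime p \<longrightarrow> bounded_from_below (padic_val p ` R)))
      \<longleftrightarrow> (\<forall>p. prime p \<longrightarrow> bounded_from_below (padic_val p ` M))"
    by (rule all_generating_sets_iff[OF M]) (unfold bounded_from_below_def, blast)
  have c4_generators: "(\<forall>R. M = generated_submonoid R \<longrightarrow> bdd_above (denominator_set (R - {0})))
      \<longleftrightarrow> bdd_above (denominator_set (M - {0}))"
    by (rule all_generating_sets_iff[OF M])
      (auto simp: denominator_set_def elim!: bdd_above_mono)
  \<comment> \<open>Any \<open>N\<close> that works for \<open>M - {0}\<close> works for \<open>0\<close> too, since \<open>0\<close> has denominator \<open>1\<close>.\<close>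
  have c3: "bdd_above (denominator_set (M - {0})) \<longleftrightarrow> ?common"
    unfolding bdd_above_denominators_iff
    by (metis DiffD1 DiffI denominator_0 one_dvd singletonD)
  have "?common \<longrightarrow> atomic M"
    using atomic_if_common_denominator[OF assms] by blast
  then show ?thesis
    unfolding Let_def c2_generators c4_generators c3 finite_valuations_bounded_iff[OF assms]
    by blast
qed

end
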